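(* Let $\alpha<1$ be real and let $g$ be the primitive of $\zeta(s+\alpha)-1$, that is, $$g(s)=-\sum_{n=2}^\infty\frac{n^{-\alpha}}{\log n}\,n^{-s}.$$ Then the Volterra operator $\mathbf{T}_g$ is unbounded on $\mathcal{H}^2$.
   Context: $\zeta$ is the Riemann zeta function. $\mathcal{H}^2$ is the Hilbert space of Dirichlet series $f(s)=\sum_{n\ge1}a_nn^{-s}$ with $\|f\|_{\mathcal{H}^2}^2=\sum_{n\ge1}|a_n|^2<\infty$. The Volterra operator with symbol $g$ is $\mathbf{T}_gf(s)=-\int_s^{+\infty}f(w)g'(w)\,dw$ (integral along the horizontal half-line from $s$, for $\mathrm{Re}\,s$ large enough), which is again a Dirichlet series. $\mathbf{T}_g$ is bounded on $\mathcal{H}^2$ if it maps $\mathcal{H}^2$ into itself with finite operator norm, and unbounded otherwise. *)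

theory Defs
  imports "HOL-Analysis.Analysis"
begin

text \<open>
  An element of \<open>H\<^sup>2\<close> is represented by its coefficient sequence \<open>a\<^sub>1, a\<^sub>2, \<dots>\<close>; the index
  \<open>0\<close> does not occur in a Dirichlet series, so \<open>a 0 = 0\<close> is required to make the
  representation unique.
\<close>

definition H2 :: "(nat \<Rightarrow> complex) set" where
  "H2 = {a. a 0 = 0 \<and> summable (\<lambda>n. (cmod (a n))\<^sup>2)}"

definition H2_norm :: "(nat \<Rightarrow> complex) \<Rightarrow> real" where
  "H2_norm a = sqrt (\<Sum>n. (cmod (a n))\<^sup>2)"

text \<open>The summand for \<open>n = 0\<close> vanishes because \<open>0 powr z = 0\<close>.\<close>

definition dirichlet_series :: "(nat \<Rightarrow> complex) \<Rightarrow> complex \<Rightarrow> complex" where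
  "dirichlet_series a s = (\<Sum>n. a n * of_nat n powr (- s))"

text \<open>The half-line from \<open>s\<close> to \<open>+\<infinity>\<close> is parametrised by \<open>w = s + t\<close> with \<open>t \<ge> 0\<close>.\<close>

definition volterra ::
    "(complex \<Rightarrow> complex) \<Rightarrow> (complex \<Rightarrow> complex) \<Rightarrow> complex \<Rightarrow> complex" where
  "volterra g f s =
     - integral {0..} (\<lambda>t::real. f (s + of_real t) * deriv g (s + of_real t))"

text \<open>
  \<open>T\<^sub>g\<close> maps \<open>H\<^sup>2\<close> into itself with finite operator norm. The formula for \<open>T\<^sub>g f\<close> only makes
  sense for \<open>Re s\<close> large enough; agreement there determines the coefficients \<open>b\<close> of
  \<open>T\<^sub>g f\<close>, by uniqueness of Dirichlet series.
\<close>

definition volterra_bounded_on_H2 :: "(complex \<Rightarrow> complex) \<Rightarrow> bool" where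
  "volterra_bounded_on_H2 g \<longleftrightarrow>
     (\<exists>C. \<forall>a\<in>H2. \<exists>b\<in>H2.
        (\<exists>\<sigma>. \<forall>s. Re s > \<sigma> \<longrightarrow>
           volterra g (dirichlet_series a) s = dirichlet_series b s) \<and>
        H2_norm b \<le> C * H2_norm a)"

text \<open>
  The symbol, with summation index shifted by \<open>2\<close>. The series converges for
  \<open>Re s > 1 - \<alpha>\<close>.
\<close>

definition zeta_primitive :: "real \<Rightarrow> complex \<Rightarrow> complex" where
  "zeta_primitive \<alpha> s =
     - (\<Sum>n. of_real (real (n + 2) powr (- \<alpha>) / ln (real (n + 2))) * of_nat (n + 2) powr (- s))"

text \<open>
  The Riemann zeta function on \<open>Re s > 1\<close>; it serves only to confirm that
  \<open>zeta_primitive \<alpha>\<close> is a primitive of \<open>\<zeta>(s + \<alpha>) - 1\<close>.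
\<close>

definition zeta_series :: "complex \<Rightarrow> complex" where
  "zeta_series s = (\<Sum>n. of_nat (n + 1) powr (- s))"

lemma zeta_primitive_has_field_derivative:
  assumes s: "Re s > 1 - \<alpha>"
  shows "(zeta_primitive \<alpha> has_field_derivative zeta_series (s + of_real \<alpha>) - 1) (at s)"
proof -
  define c where "c = (1 - \<alpha> + Re s) / 2"
  have c: "1 - \<alpha> < c" "c < Re s" using s by (auto simp: c_def field_simps)
  define S where "S = {z. Re z > c}"
  define f where "f = (\<lambda>(n::nat) (z::complex).
    - (of_real (real (n + 2) powr (- \<alpha>) / ln (real (n + 2))) * of_nat (n + 2) powr (- z)))"
  define f' where "f' = (\<lambda>(n::nat) (z::complex). (of_nat (n + 2) :: complex) powr (- (z + of_real \<alpha>)))"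
  define B where "B = (\<lambda>n::nat. real (n + 2) powr (- (c + \<alpha>)))"
  have opS: "open S" unfolding S_def by (rule open_halfspace_Re_gt)
  have convS: "convex S" unfolding S_def by (rule convex_halfspace_Re_gt)
  have sS: "s \<in> S" using c by (simp add: S_def)
  have summB: "summable B"
  proof -
    have "summable (\<lambda>n. real n powr (- (c + \<alpha>)))"
      using c by (subst summable_real_powr_iff) auto
    thus ?thesis unfolding B_def
      using summable_iff_shift[of "\<lambda>n. real n powr (- (c + \<alpha>))" 2] by simp
  qed
  have norm_powr: "norm ((of_nat (n + 2) :: complex) powr z) = real (n + 2) powr Re z" for n z
    using norm_powr_real_powr[of "of_nat (n + 2)" z] by (simp del: of_nat_add)
  have bound': "norm (f' n z) \<le> B n" if "z \<in> S" for n z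
    unfolding f'_def B_def norm_powr using that by (intro powr_mono) (auto simp: S_def)
  have ln_eq: "Ln (of_nat (n + 2)) = of_real (ln (real (n + 2)))" for n
    using Ln_of_real[of "real (n + 2)"] by (simp del: of_nat_add)
  have powr_of_real: "complex_of_real (real (n + 2) powr (- \<alpha>)) = of_nat (n + 2) powr (- of_real \<alpha>)" for n
    using powr_of_real[of "real (n + 2)" "- \<alpha>"] by (simp del: of_nat_add)
  have deriv_f: "(f n has_field_derivative f' n z) (at z)" for n z
  proof -
    have nz: "complex_of_real (ln (real (n + 2))) \<noteq> 0" by simp
    have nz2: "(of_nat (n + 2) :: complex) \<noteq> 0" unfolding of_nat_eq_0_iff by simp
    have "(f n has_field_derivative
       - (of_real (real (n + 2) powr (- \<alpha>) / ln (real (n + 2))) *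
          (- (Ln (of_nat (n + 2)) * of_nat (n + 2) powr (- z))))) (at z)"
    proof -
      have "((\<lambda>z. w powr (- z)) has_field_derivative - (Ln w * w powr (- z))) (at z)"
        if "w \<noteq> 0" for w :: complex
        using DERIV_chain2[OF has_field_derivative_powr_right[OF that] DERIV_minus[OF DERIV_ident]]
        by simp
      from DERIV_minus[OF DERIV_cmult[OF this[OF nz2]]] show ?thesis
        unfolding f_def .
    qed
    also have "- (of_real (real (n + 2) powr (- \<alpha>) / ln (real (n + 2))) *
          (- (Ln (of_nat (n + 2)) * of_nat (n + 2) powr (- z)))) =
          of_nat (n + 2) powr (- of_real \<alpha>) * (of_nat (n + 2) :: complex) powr (- z)"
    proof -
      have "- (a / l * (- (l * w))) = a * w" if "l \<noteq> 0" for a l w :: complex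
        using that by simp
      from this[OF nz] show ?thesis unfolding ln_eq of_real_divide powr_of_real .
    qed
    also have "\<dots> = f' n z"
    proof -
      have "w powr (- x) * w powr (- y) = w powr (- (y + x))" for w x y :: complex
        by (metis add.commute minus_add_distrib powr_add)
      thus ?thesis unfolding f'_def .
    qed
    finally show ?thesis .
  qed
  have "norm (f n s) \<le> B n / ln 2" for n
  proof -
    have l: "ln 2 \<le> ln (real (n + 2))" by simp
    have p: "(0::real) < ln 2" by simp
    have "norm (f n s) = real (n + 2) powr (- \<alpha>) / ln (real (n + 2)) * real (n + 2) powr (- Re s)"
      unfolding f_def norm_minus_cancel norm_mult norm_powr using l p
      by (simp del: of_nat_add of_real_divide)
    also have "\<dots> = real (n + 2) powr (- (Re s + \<alpha>)) / ln (real (n + 2))"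
      by (simp add: powr_add[symmetric] algebra_simps)
    also have "\<dots> \<le> B n / ln 2" unfolding B_def
      using l p c by (intro frac_le powr_mono) auto
    finally show ?thesis .
  qed
  hence summ_s: "summable (\<lambda>n. f n s)"
    by (intro summable_comparison_test'[OF summable_divide[OF summB, of "ln 2"], of 0]) auto
  have unif: "uniformly_convergent_on S (\<lambda>n z. \<Sum>i<n. f' i z)"
    using bound' summB by (intro Weierstrass_m_test'[of S f' B]) auto
  have D: "((\<lambda>z. \<Sum>n. f n z) has_field_derivative (\<Sum>n. f' n s)) (at s)"
    by (rule has_field_derivative_series'(2)[where f = f and f' = f', OF convS _ unif sS summ_s])
       (use deriv_f sS opS in \<open>auto simp: interior_open intro: DERIV_subset\<close>)
  have summable_f: "summable (\<lambda>n. f n z)" if "z \<in> S" for z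
    by (rule has_field_derivative_series'(1)[where f = f and f' = f', OF convS _ unif sS summ_s])
       (use deriv_f that opS in \<open>auto simp: interior_open intro: DERIV_subset\<close>)
  have eq: "(\<Sum>n. f n z) = zeta_primitive \<alpha> z" if "z \<in> S" for z
    using suminf_minus[OF summable_minus[OF summable_f[OF that]]]
    unfolding f_def zeta_primitive_def by simp
  have "(zeta_primitive \<alpha> has_field_derivative (\<Sum>n. f' n s)) (at s)"
    by (rule has_field_derivative_transform_within_open[OF D opS sS]) (use eq in auto)
  moreover have "(\<Sum>n. f' n s) = zeta_series (s + of_real \<alpha>) - 1"
  proof -
    define h where "h = (\<lambda>n::nat. (of_nat (n + 1) :: complex) powr (- (s + of_real \<alpha>)))"
    have "summable (\<lambda>n. f' n s)"
      by (intro summable_comparison_test'[OF summB, of 0]) (use bound' sS in auto)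
    moreover have f'h: "f' n s = h (Suc n)" for n by (simp add: f'_def h_def)
    ultimately have "summable h" using summable_Suc_iff[of h] by simp
    from suminf_split_head[OF this] show ?thesis
      by (simp add: f'h zeta_series_def h_def)
  qed
  ultimately show ?thesis by simp
qed

end

theory Submission
  imports Defs "HOL-Real_Asymp.Real_Asymp" "HOL-Computational_Algebra.Primes"
begin

text \<open>
  Up to sign, the \<open>N\<close>-th coefficient of \<open>T\<^sub>g f\<close> is \<open>1 / log N\<close> times the sum of
  \<open>a\<^sub>m (N / m)\<^sup>-\<^sup>\<alpha>\<close> over the proper divisors \<open>m\<close> of \<open>N\<close>. Take for \<open>a\<close> the indicator of the
  divisors of the product of the \<open>K = \<pi>(x)\<close> primes up to \<open>x\<close>, and put \<open>q = 1 + x\<^sup>-\<^sup>\<beta>\<close> with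
  \<open>\<beta> \<ge> \<alpha>\<close>, \<open>0 < \<beta> < 1\<close>. If \<open>N\<close> is such a divisor with \<open>j\<close> prime factors, its coefficient is at least
  \<open>(q\<^sup>j - 1) / (K log x)\<close>. Since \<open>(q\<^sup>j - 1)\<^sup>2 \<ge> q\<^sup>2\<^sup>j / 2 - 1\<close>, summing over all subsets of the primes
  and using \<open>1 + q\<^sup>2 \<ge> 2 q\<close> shows that a bound \<open>C\<close> on the operator norm satisfies
  \<open>C\<^sup>2 (K log x)\<^sup>2 \<ge> q\<^sup>K / 2 - 1\<close>. As \<open>K\<close> is at least a constant times \<open>x / log x\<close>, the right-hand
  side grows like the exponential of a positive power of \<open>x\<close>, a contradiction.
\<close>

section \<open>A Chebyshev-type lower bound for the number of primes, and the growth it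
  forces\<close>

text \<open>
  The numbers \<open>1 / (m (n choose m))\<close> form Leibniz's harmonic triangle, in which each entry is a
  difference of two entries with smaller \<open>m\<close>.
\<close>

lemma common_multiple_div_binomial_in_Ints:
  fixes D :: nat
  assumes "\<And>j. 1 \<le> j \<Longrightarrow> j \<le> n \<Longrightarrow> j dvd D" "1 \<le> m" "m \<le> n"
  shows "real D / (real m * real (n choose m)) \<in> \<int>"
  using assms(2,3,1)
proof (induction m arbitrary: n rule: dec_induct)
  case base
  then have "n dvd D" by auto
  then show ?case by (auto elim!: dvdE)
next
  case (step m)
  obtain n' where n: "n = Suc n'" using step.prems by (cases n) auto
  have "m \<le> n'" using step.prems n by simp
  let ?c = "real (n' choose m)"
  have c: "?c > 0" using \<open>m \<le> n'\<close> by simp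
  have 1: "real (Suc m) * real (n choose Suc m) = real n * ?c"
    using Suc_times_binomial_eq[of n' m] unfolding n by (metis mult.commute of_nat_mult)
  have 2: "real (n - m) * real (n choose m) = real n * ?c"
    using binomial_absorb_comp[of n m] unfolding n by (metis diff_Suc_1 of_nat_mult)
  have m: "real m > 0" "real (n - m) > 0" "real n > 0" using step n \<open>m \<le> n'\<close> by auto
  have 3: "real (n choose m) = real n * ?c / real (n - m)" using 2 m by (simp add: field_simps)
  have nm: "real (n - m) = real n - real m" using step.prems by simp
  \<comment> \<open>The recursion of the triangle is 1/((m+1) C(n,m+1)) = 1/(m C(n-1,m)) - 1/(m
    C(n,m)). One entry on the right lies in row n-1, which is why the induction on \<open>m\<close>
    keeps \<open>n\<close> arbitrary.\<close>
  have "real D / (real (Suc m) * real (n choose Suc m)) =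
        real D / (real m * ?c) - real D / (real m * real (n choose m))"
    unfolding 1 3 using m c nm by (simp add: field_simps)
  moreover have "real D / (real m * ?c) \<in> \<int>"
    using step.IH[of n'] \<open>m \<le> n'\<close> step.prems n by auto
  moreover have "real D / (real m * real (n choose m)) \<in> \<int>"
    using step.IH[of n] step.prems by auto
  ultimately show ?case by auto
qed

text \<open>The quotient D / (m C(n,m)) is an integer by the triangle argument and positive, so it
  is at least 1.\<close>

lemma common_multiple_ge_binomial:
  fixes D :: nat
  assumes "\<And>j. 1 \<le> j \<Longrightarrow> j \<le> n \<Longrightarrow> j dvd D" "1 \<le> m" "m \<le> n" "D > 0"
  shows "m * (n choose m) \<le> D"
proof -
  have p: "real m * real (n choose m) > 0" using assms by simp
  then have "real D / (real m * real (n choose m)) > 0" using assms by simp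
  with common_multiple_div_binomial_in_Ints[OF assms(1-3)] have "real D / (real m * real (n choose m)) \<ge> 1"
    by (metis Ints_cases int_one_le_iff_zero_less of_int_0_less_iff of_int_1_le_iff)
  with p have "real (m * (n choose m)) \<le> real D" by (simp add: field_simps)
  then show ?thesis by linarith
qed

text \<open>Nair's argument: lcm(1, ..., 2k) is at least k C(2k,k) \<ge> 2^k, yet it is a product of
  prime powers not exceeding 2k, one for each prime up to 2k. Taking logarithms gives \<pi>(2k)
  \<ge> k ln 2 / ln (2k).\<close>

lemma two_power_le_prime_count:
  assumes "k \<ge> 1"
  shows "2 ^ k \<le> (2 * k) ^ card {p. prime p \<and> p \<le> 2 * k}"
proof -
  define n where "n = 2 * k"
  define P where "P = {p. prime p \<and> p \<le> n}"
  \<comment> \<open>For a prime p in \<open>P\<close>, \<open>e p\<close> is its exponent in lcm(1,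
    ..., n), so \<open>D\<close> is that least common multiple.\<close>
  define e where "e = (\<lambda>p. Max {e. p ^ e \<le> n})"
  define D where "D = (\<Prod>p\<in>P. p ^ e p)"
  have fin: "finite P" unfolding P_def by simp
  have n: "n \<ge> 1" using assms by (simp add: n_def)
  \<comment> \<open>\<open>Max\<close> is meaningful only on a finite nonempty set; i < 2^i \<le>
    p^i \<le> n bounds the admissible exponents.\<close>
  have fe: "finite {e. p ^ e \<le> n}" if "p \<in> P" for p
  proof (rule finite_subset)
    show "{e. p ^ e \<le> n} \<subseteq> {..n}"
    proof safe
      fix i assume "p ^ i \<le> n"
      moreover have "2 ^ i \<le> p ^ i" using that by (intro power_mono) (auto simp: P_def prime_ge_2_nat)
      moreover have "i < 2 ^ i" by simp
      ultimately show "i \<le> n" by linarith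
    qed
  qed simp
  have pe: "p ^ e p \<le> n" if "p \<in> P" for p
  proof -
    have "p ^ 0 \<le> n" using n by simp
    then have "{e. p ^ e \<le> n} \<noteq> {}" by blast
    from Max_in[OF fe[OF that] this] show ?thesis by (simp add: e_def)
  qed
  have e_ge: "i \<le> e p" if "p \<in> P" "p ^ i \<le> n" for p i
    unfolding e_def using fe[OF that(1)] that(2) by (intro Max_ge) auto
  have Dpos: "D > 0" unfolding D_def by (auto simp: P_def prime_gt_0_nat intro!: prod_pos)
  have "j dvd D" if "1 \<le> j" "j \<le> n" for j
  proof (rule multiplicity_le_imp_dvd)
    fix p :: nat assume p: "prime p"
    show "multiplicity p j \<le> multiplicity p D"
    proof (cases "p dvd j")
      case False then show ?thesis by (simp add: not_dvd_imp_multiplicity_0)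
    next
      case True
      then have "p \<in> P" using p that by (auto simp: P_def dest: dvd_imp_le)
      have "p ^ multiplicity p j \<le> n"
        using that dvd_imp_le[OF multiplicity_dvd[of p j]] by simp
      then have "multiplicity p j \<le> e p" using e_ge \<open>p \<in> P\<close> by blast
      also have "e p \<le> multiplicity p D"
      proof (rule multiplicity_geI)
        show "p ^ e p dvd D" unfolding D_def using fin \<open>p \<in> P\<close> by (rule dvd_prodI)
        show "\<not> is_unit p" using p by auto
        show "D \<noteq> 0" using Dpos by simp
      qed
      finally show ?thesis .
    qed
  qed (use that in auto)
  from common_multiple_ge_binomial[OF this, of n k] have "k * (n choose k) \<le> D"
    using assms Dpos by (simp add: n_def)
  also have "D \<le> (\<Prod>p\<in>P. n)" unfolding D_def by (intro prod_mono) (use pe in auto)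
  also have "\<dots> = n ^ card P" by simp
  finally have "k * (n choose k) \<le> n ^ card P" .
  moreover have "2 ^ k \<le> k * (n choose k)"
  proof -
    have "real (2 ^ k) \<le> (2 * real k / k) ^ k" using assms by simp
    also have "\<dots> \<le> real (n choose k)"
      using binomial_ge_n_over_k_pow_k[of k n, where 'a = real] by (simp add: n_def)
    finally have "2 ^ k \<le> n choose k" by linarith
    also have "\<dots> \<le> k * (n choose k)" using assms by simp
    finally show ?thesis .
  qed
  ultimately show ?thesis unfolding P_def n_def by linarith
qed

text \<open>The exponent has order x^(1-\<beta>) / ln x, which outgrows every multiple of ln x
  because \<beta> < 1. Its factor ln 2 * x / (2 ln x) is the lower bound for the number of primes up
  to x = 2k.\<close>

lemma prime_growth_dominates:
  fixes C \<beta> :: real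
  assumes "0 < \<beta>" "\<beta> < 1"
  shows "eventually (\<lambda>x::real. C * (x * ln x)\<^sup>2 <
           exp (ln 2 * x / (2 * ln x) * ln (1 + x powr -\<beta>)) / 2 - 1) at_top"
proof -
  have "filterlim (\<lambda>x::real. (exp (ln 2 * x / (2 * ln x) * ln (1 + x powr -\<beta>)) / 2 - 1) / (x * ln x)\<^sup>2)
          at_top at_top"
    using assms by real_asymp
  then have "eventually (\<lambda>x. C < (exp (ln 2 * x / (2 * ln x) * ln (1 + x powr -\<beta>)) / 2 - 1) / (x * ln x)\<^sup>2) at_top"
    by (simp add: filterlim_at_top_dense)
  then show ?thesis using eventually_gt_at_top[of 1]
  proof eventually_elim
    case (elim x)
    then have "(x * ln x)\<^sup>2 > 0" by simp
    with elim(1) show ?case by (simp add: pos_less_divide_eq)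
  qed
qed

section \<open>Uniqueness of Dirichlet coefficients\<close>

text \<open>Once all earlier coefficients vanish, the n-th term equals minus the tail beyond n,
  which is smaller by a factor of order (n/(n+1))^\<tau>. Vanishing on a real ray suffices, so the
  Volterra integral has to be evaluated at real points only.\<close>

lemma dirichlet_coeffs_eq_0:
  fixes d :: "nat \<Rightarrow> complex"
  assumes "d 0 = 0"
    and summ: "summable (\<lambda>n. cmod (d n) * real n powr (-\<sigma>))"
    and zero: "\<And>x::real. x > \<sigma> \<Longrightarrow> dirichlet_series d (of_real x) = 0"
  shows "d n = 0"
proof (induction n rule: less_induct)
  case (less n)
  show ?case
  proof (cases "n = 0")
    case False
    define S where "S = (\<Sum>k. cmod (d k) * real k powr (-\<sigma>))"
    text \<open>As \<open>\<tau> \<rightarrow> \<infinity>\<close>, all terms after the \<open>n\<close>-th become negligible relative to it.\<close>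
    have bound: "cmod (d n) * real n powr (-\<sigma>) \<le> (real n / real (n + 1)) powr \<tau> * S" if "\<tau> > 0" for \<tau>
    proof -
      define x where "x = \<sigma> + \<tau>"
      define f where "f = (\<lambda>k. d k * of_nat k powr (- of_real x))"
      have norm_f: "cmod (f k) = cmod (d k) * real k powr (-\<sigma>) * real k powr (-\<tau>)" for k
        unfolding f_def norm_mult using norm_powr_real_powr[of "of_nat k" "- of_real x"]
        by (simp add: x_def powr_add[symmetric] algebra_simps)
      have rest: "cmod (if k = n then 0 else f k) \<le>
           real (n + 1) powr (-\<tau>) * (cmod (d k) * real k powr (-\<sigma>))" for k
      proof (cases "k \<le> n")
        case True
        then show ?thesis using less.IH[of k] by (auto simp: f_def)
      next
        case gt: False
        have "real k powr (-\<tau>) \<le> real (n + 1) powr (-\<tau>)"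
          using gt that by (intro powr_mono2') auto
        then show ?thesis using gt
          by (simp add: norm_f mult.commute[of "(1 + real n) powr _"] mult_left_mono)
      qed
      have summ': "summable (\<lambda>k. real (n + 1) powr (-\<tau>) * (cmod (d k) * real k powr (-\<sigma>)))"
        using summ by (rule summable_mult)
      have s1: "summable (\<lambda>k. cmod (if k = n then 0 else f k))"
        by (rule summable_comparison_test'[OF summ', of 0]) (use rest in auto)
      have s2: "(\<lambda>k. if k = n then f k else 0) sums f n" by (rule sums_single)
      have "(\<lambda>k. (if k = n then f k else 0) + (if k = n then 0 else f k)) sums
              (f n + (\<Sum>k. if k = n then 0 else f k))"
        by (intro sums_add s2 summable_sums summable_norm_cancel[OF s1])
      also have "(\<lambda>k. (if k = n then f k else 0) + (if k = n then 0 else f k)) = f" by auto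
      finally have "(\<Sum>k. f k) = f n + (\<Sum>k. if k = n then 0 else f k)" by (simp add: sums_iff)
      moreover have "(\<Sum>k. f k) = 0"
        using zero[of x] that by (simp add: dirichlet_series_def f_def x_def)
      ultimately have "f n = - (\<Sum>k. if k = n then 0 else f k)" by (simp add: add_eq_0_iff)
      then have "cmod (f n) = cmod (\<Sum>k. if k = n then 0 else f k)" by simp
      also have "\<dots> \<le> (\<Sum>k. cmod (if k = n then 0 else f k))" by (rule summable_norm[OF s1])
      also have "\<dots> \<le> (\<Sum>k. real (n + 1) powr (-\<tau>) * (cmod (d k) * real k powr (-\<sigma>)))"
        by (intro suminf_le rest s1 summ')
      also have "\<dots> = real (n + 1) powr (-\<tau>) * S" unfolding S_def by (rule suminf_mult[OF summ])
      finally have "cmod (d n) * real n powr (-\<sigma>) * real n powr (-\<tau>) \<le> real (n + 1) powr (-\<tau>) * S"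
        unfolding norm_f .
      then have "cmod (d n) * real n powr (-\<sigma>) * real n powr (-\<tau>) * real n powr \<tau> \<le>
                 real (n + 1) powr (-\<tau>) * S * real n powr \<tau>"
        by (rule mult_right_mono) simp
      moreover have "real n powr (-\<tau>) * real n powr \<tau> = 1"
        using False by (simp add: powr_minus)
      moreover have "real (n + 1) powr (-\<tau>) * real n powr \<tau> = (real n / real (n + 1)) powr \<tau>"
        by (simp add: powr_divide powr_minus divide_simps)
      ultimately show ?thesis by (metis mult.assoc mult.commute mult.right_neutral)
    qed
    have "((\<lambda>\<tau>. r powr \<tau>) \<longlongrightarrow> 0) at_top" if "0 < r" "r < 1" for r :: real
      using that by real_asymp
    from this[of "real n / real (n + 1)"]
    have "((\<lambda>\<tau>. (real n / real (n + 1)) powr \<tau> * S) \<longlongrightarrow> 0 * S) at_top"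
      using False by (intro tendsto_mult tendsto_const) auto
    then have "cmod (d n) * real n powr (-\<sigma>) \<le> 0 * S"
      by (rule tendsto_lowerbound)
        (use eventually_mono[OF eventually_gt_at_top[of 0] bound] in simp_all)
    then show ?thesis using False
      by (metis mult_zero_left mult_le_0_iff norm_le_zero_iff not_le powr_gt_zero of_nat_eq_0_iff)
  qed (use assms in simp)
qed

section \<open>The coefficients of T_g f for a Dirichlet polynomial f with coefficients 0 and
  1\<close>

text \<open>For finite D without 0 this is the N-th coefficient of f * g', where f(s) is the sum of
  m^-s over D and g'(s) = zeta(s+\<alpha>) - 1. Divisors are proper because subtracting 1 removes
  the first term of the zeta series.\<close>

definition proper_divisor_sum :: "real \<Rightarrow> nat set \<Rightarrow> nat \<Rightarrow> real" where
  "proper_divisor_sum \<alpha> D N = (\<Sum>m\<in>{m\<in>D. m dvd N \<and> m < N}. real (N div m) powr (-\<alpha>))"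

lemma proper_divisor_sum_nonneg: "proper_divisor_sum \<alpha> D N \<ge> 0"
  unfolding proper_divisor_sum_def by (intro sum_nonneg) auto

lemma proper_divisor_sum_le_1:
  assumes "0 \<notin> D" "N \<le> 1"
  shows "proper_divisor_sum \<alpha> D N = 0"
proof -
  have "{m\<in>D. m dvd N \<and> m < N} = {}" using assms by (auto simp: le_Suc_eq)
  then show ?thesis by (simp only: proper_divisor_sum_def sum.empty)
qed

lemma summable_shifted_powr:
  assumes "x > (1::real)"
  shows "summable (\<lambda>n. real (n + 2) powr (-x))"
proof -
  have "summable (\<lambda>n. real n powr (-x))"
    using assms by (subst summable_real_powr_iff) auto
  then show ?thesis using summable_iff_shift[of "\<lambda>n. real n powr (-x)" 2] by simp
qed

text \<open>For fixed m and N = m(n+2), N^-x (N/m)^-\<alpha> splits as m^-x (n+2)^-(x+\<alpha>). As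
  \<open>D\<close> is finite, the sums over m and N may be interchanged.\<close>

lemma proper_divisor_sum_sums:
  assumes D: "finite D" "0 \<notin> D" and x: "x > 1 - \<alpha>"
  shows "(\<lambda>N. proper_divisor_sum \<alpha> D N * real N powr (-x)) sums
           ((\<Sum>m\<in>D. real m powr (-x)) * (\<Sum>n. real (n + 2) powr (-(x + \<alpha>))))"
proof -
  define Z where "Z = (\<Sum>n. real (n + 2) powr (-(x + \<alpha>)))"
  define f where "f = (\<lambda>m N. if m dvd N \<and> m < N then real (N div m) powr (-\<alpha>) * real N powr (-x) else 0)"
  have "f m sums (real m powr (-x) * Z)" if m: "m \<in> D" for m
  proof -
    have mpos: "m > 0" using m D by (cases m) auto
    define g where "g = (\<lambda>n. m * (n + 2))"
    have mono: "strict_mono g" unfolding g_def strict_mono_def using mpos by simp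
    \<comment> \<open>A proper multiple of m has cofactor at least 2, so \<open>g\<close> enumerates
      all of them; \<open>f m\<close> vanishes elsewhere, and reindexing along \<open>g\<close>
      loses nothing.\<close>
    have range: "N \<in> range g" if "m dvd N" "m < N" for N
    proof -
      obtain k where k: "N = m * k" using \<open>m dvd N\<close> by auto
      have "k \<ge> 2" using k \<open>m < N\<close> by (cases k; cases "k - 1") auto
      then have "k - 2 + 2 = k" by simp
      then have "N = g (k - 2)" by (simp only: g_def k)
      then show ?thesis by blast
    qed
    have fg: "f m (g n) = real m powr (-x) * real (n + 2) powr (-(x + \<alpha>))" for n
    proof -
      have "f m (g n) = real (n + 2) powr (-\<alpha>) * real (m * (n + 2)) powr (-x)"
        using mpos by (simp add: f_def g_def)
      also have "real (m * (n + 2)) powr (-x) = real m powr (-x) * real (n + 2) powr (-x)"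
        unfolding of_nat_mult by (rule powr_mult)
      finally show ?thesis by (simp add: powr_add[symmetric] algebra_simps)
    qed
    have "(\<lambda>n. f m (g n)) sums (real m powr (-x) * Z)"
      unfolding fg Z_def by (intro sums_mult summable_sums summable_shifted_powr) (use x in auto)
    then show ?thesis
      by (subst (asm) sums_mono_reindex[OF mono]) (use range in \<open>auto simp: f_def\<close>)
  qed
  then have "(\<lambda>N. \<Sum>m\<in>D. f m N) sums (\<Sum>m\<in>D. real m powr (-x) * Z)"
    by (intro sums_sum)
  also have "(\<lambda>N. \<Sum>m\<in>D. f m N) = (\<lambda>N. proper_divisor_sum \<alpha> D N * real N powr (-x))"
    using D(1) by (auto simp: f_def proper_divisor_sum_def sum_distrib_right sum.inter_filter intro!: ext sum.cong)
  finally show ?thesis by (simp add: Z_def sum_distrib_right)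
qed

definition indicator_coeffs :: "nat set \<Rightarrow> nat \<Rightarrow> complex" where
  "indicator_coeffs D n = (if n \<in> D then 1 else 0)"

lemma of_nat_powr_of_real: "(of_nat n :: complex) powr of_real x = of_real (real n powr x)"
  using powr_of_real[of "real n" x] by simp

lemma dirichlet_series_indicator_coeffs:
  assumes "finite D"
  shows "dirichlet_series (indicator_coeffs D) (of_real x) = of_real (\<Sum>m\<in>D. real m powr (-x))"
proof -
  have "dirichlet_series (indicator_coeffs D) (of_real x) =
          (\<Sum>n\<in>D. indicator_coeffs D n * of_nat n powr (- of_real x))"
    unfolding dirichlet_series_def by (intro suminf_finite assms) (auto simp: indicator_coeffs_def)
  also have "\<dots> = (\<Sum>n\<in>D. of_real (real n powr (-x)))"
    by (intro sum.cong) (use of_nat_powr_of_real[of _ "-x"] in \<open>auto simp: indicator_coeffs_def\<close>)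
  finally show ?thesis by simp
qed

lemma deriv_zeta_primitive_of_real:
  assumes x: "x > 1 - \<alpha>"
  shows "deriv (zeta_primitive \<alpha>) (of_real x) = of_real (\<Sum>n. real (n + 2) powr (-(x + \<alpha>)))"
proof -
  define f where "f = (\<lambda>n. real (n + 1) powr (-(x + \<alpha>)))"
  have s: "summable (\<lambda>n. f (Suc n))" using summable_shifted_powr[of "x + \<alpha>"] x by (simp add: f_def)
  then have sf: "summable f" by (simp add: summable_Suc_iff)
  have "zeta_series (of_real x + of_real \<alpha>) = (\<Sum>n. of_real (f n))"
    unfolding zeta_series_def f_def
    by (intro suminf_cong) (use of_nat_powr_of_real[of "_ + 1" "-(x + \<alpha>)"] in simp)
  also have "\<dots> = of_real (\<Sum>n. f n)" using sf by (simp add: suminf_of_real)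
  also have "(\<Sum>n. f n) = (\<Sum>n. f (Suc n)) + 1" using suminf_split_head[OF sf] by (simp add: f_def)
  finally have "zeta_series (of_real x + of_real \<alpha>) - 1 = of_real (\<Sum>n. f (Suc n))" by simp
  moreover have "deriv (zeta_primitive \<alpha>) (of_real x) = zeta_series (of_real x + of_real \<alpha>) - 1"
    using x by (intro DERIV_imp_deriv zeta_primitive_has_field_derivative) auto
  ultimately show ?thesis by (simp add: f_def)
qed

lemma has_integral_nat_powr:
  assumes "N \<ge> 2"
  shows "((\<lambda>t. real N powr (-(s + t))) has_integral real N powr (-s) / ln (real N)) {0..}"
proof -
  have "((\<lambda>t. real N powr (-s) * exp (- ln (real N) * t)) has_integral
          real N powr (-s) * (exp (- ln (real N) * 0) / ln (real N))) {0..}"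
    by (intro has_integral_mult_right has_integral_exp_minus_to_infinity) (use assms in auto)
  moreover have "real N powr (-s) * exp (- ln (real N) * t) = real N powr (-(s + t))" for t
    using assms by (simp add: powr_def exp_add[symmetric] algebra_simps)
  ultimately show ?thesis by simp
qed

text \<open>At real points all terms of the series of f * g' are nonnegative, so monotone
  convergence permits termwise integration; N^-(s+t) integrates to N^-s / ln N, which is the source
  of the logarithm in \<open>c\<close>.\<close>

lemma volterra_indicator_coeffs:
  assumes D: "finite D" "0 \<notin> D" and s: "s > 1 - \<alpha>"
  defines "c \<equiv> \<lambda>N. proper_divisor_sum \<alpha> D N / ln (real N)"
  shows "summable (\<lambda>N. c N * real N powr (-s))"
    and "volterra (zeta_primitive \<alpha>) (dirichlet_series (indicator_coeffs D)) (of_real s) =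
           - of_real (\<Sum>N. c N * real N powr (-s))"
proof -
  let ?e = "proper_divisor_sum \<alpha> D"
  define h where "h = (\<lambda>x. (\<Sum>m\<in>D. real m powr (-x)) * (\<Sum>n. real (n + 2) powr (-(x + \<alpha>))))"
  have term_int: "((\<lambda>t. ?e N * real N powr (-(s + t))) has_integral c N * real N powr (-s)) {0..}" for N
  \<comment> \<open>For N \<le> 1 the coefficient \<open>?e N\<close> is 0, so neither the lack of
    decay of 1^-(s+t) nor the denominator ln 1 = 0 does harm.\<close>
  proof (cases "N \<le> 1")
    case True
    then show ?thesis using proper_divisor_sum_le_1[OF D(2) True] by (simp add: c_def)
  next
    case False
    have "((\<lambda>t. ?e N * real N powr (-(s + t))) has_integral ?e N * (real N powr (-s) / ln (real N))) {0..}"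
      by (intro has_integral_mult_right has_integral_nat_powr) (use False in auto)
    then show ?thesis by (simp add: c_def)
  qed
  have sums: "(\<lambda>N. ?e N * real N powr (-x)) sums h x" if "x > 1 - \<alpha>" for x
    unfolding h_def by (rule proper_divisor_sum_sums[OF D that])
  show summ: "summable (\<lambda>N. c N * real N powr (-s))"
  proof (rule summable_comparison_test')
    show "summable (\<lambda>N. ?e N * real N powr (-s) / ln 2)"
      using sums[OF s] by (intro summable_divide) (auto simp: sums_iff)
    fix N :: nat assume "N \<ge> 2"
    then have "c N \<le> ?e N / ln 2" unfolding c_def
      by (intro divide_left_mono) (auto simp: proper_divisor_sum_nonneg)
    then have "c N * real N powr (-s) \<le> ?e N / ln 2 * real N powr (-s)"
      by (rule mult_right_mono) simp
    moreover have "c N \<ge> 0" using \<open>N \<ge> 2\<close> by (simp add: c_def proper_divisor_sum_nonneg)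
    ultimately show "norm (c N * real N powr (-s)) \<le> ?e N * real N powr (-s) / ln 2" by simp
  qed
  have "((\<lambda>t. h (s + t)) has_integral (\<Sum>N. c N * real N powr (-s))) {0..}"
  proof (rule has_integral_monotone_convergence_increasing)
    show "((\<lambda>t. \<Sum>N<k. ?e N * real N powr (-(s + t))) has_integral (\<Sum>N<k. c N * real N powr (-s))) {0..}" for k
      by (intro has_integral_sum term_int) auto
    show "(\<Sum>N<k. ?e N * real N powr (-(s + t))) \<le> (\<Sum>N<Suc k. ?e N * real N powr (-(s + t)))" for k t
      by (simp add: proper_divisor_sum_nonneg)
    show "(\<lambda>k. \<Sum>N<k. ?e N * real N powr (-(s + t))) \<longlonglongrightarrow> h (s + t)" if "t \<in> {0..}" for t
      using sums[of "s + t"] that s unfolding sums_def by simp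
    show "(\<lambda>k. \<Sum>N<k. c N * real N powr (-s)) \<longlonglongrightarrow> (\<Sum>N. c N * real N powr (-s))"
      using summ by (rule summable_LIMSEQ)
  qed
  then have "((\<lambda>t. complex_of_real (h (s + t))) has_integral of_real (\<Sum>N. c N * real N powr (-s))) {0..}"
    by (rule has_integral_of_real)
  moreover have "complex_of_real (h (s + t)) =
      dirichlet_series (indicator_coeffs D) (of_real s + of_real t) *
      deriv (zeta_primitive \<alpha>) (of_real s + of_real t)" if "t \<in> {0..}" for t
    using dirichlet_series_indicator_coeffs[OF D(1), of "s + t"]
      deriv_zeta_primitive_of_real[of \<alpha> "s + t"] s that
    by (simp add: h_def)
  ultimately have "((\<lambda>t. dirichlet_series (indicator_coeffs D) (of_real s + of_real t) *
      deriv (zeta_primitive \<alpha>) (of_real s + of_real t)) has_integral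
      of_real (\<Sum>N. c N * real N powr (-s))) {0..}"
    by (subst (asm) has_integral_cong) auto
  then show "volterra (zeta_primitive \<alpha>) (dirichlet_series (indicator_coeffs D)) (of_real s) =
           - of_real (\<Sum>N. c N * real N powr (-s))"
    unfolding volterra_def by (simp add: integral_unique)
qed

text \<open>The coefficients of T_g f are -c, so the Dirichlet series of b + c vanishes at all large
  real points and uniqueness applies.\<close>

lemma volterra_indicator_coeffs_unique:
  assumes D: "finite D" "0 \<notin> D" and b: "b \<in> H2"
    and eq: "\<And>s. Re s > \<sigma> \<Longrightarrow>
      volterra (zeta_primitive \<alpha>) (dirichlet_series (indicator_coeffs D)) s = dirichlet_series b s"
  shows "b N = - of_real (proper_divisor_sum \<alpha> D N / ln (real N))"
proof -
  define c where "c N = proper_divisor_sum \<alpha> D N / ln (real N)" for N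
  define d where "d = (\<lambda>N. b N + of_real (c N))"
  \<comment> \<open>Beyond \<open>\<tau>\<close> three things hold: the assumed identity for
    \<open>b\<close> (x > \<sigma>), convergence of the sum of n^(-2x) (x \<ge> 2), and the formula
    for the Volterra integral (x > 1 - \<alpha>).\<close>
  define \<tau> where "\<tau> = max \<sigma> (max 2 (2 - \<alpha>))"
  note V = volterra_indicator_coeffs[OF D, of \<alpha>, folded c_def]
  have c_nonneg: "c N \<ge> 0" for N
    by (cases "N = 0") (simp_all add: c_def proper_divisor_sum_nonneg)
  \<comment> \<open>Square summability gives absolute convergence through 2uv \<le> u^2 + v^2 with u
    = |b_n| and v = n^-x.\<close>
  have summ_b: "summable (\<lambda>n. cmod (b n) * real n powr (-x))" if x: "x \<ge> \<tau>" for x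
  proof (rule summable_comparison_test')
    have "summable (\<lambda>n. real n powr (-(2 * x)))"
      using x by (subst summable_real_powr_iff) (auto simp: \<tau>_def)
    moreover have "summable (\<lambda>n. (cmod (b n))\<^sup>2)" using b by (simp add: H2_def)
    ultimately show "summable (\<lambda>n. (cmod (b n))\<^sup>2 + real n powr (-(2 * x)))" by (intro summable_add)
    fix n :: nat
    have "2 * (cmod (b n) * real n powr (-x)) \<le> (cmod (b n))\<^sup>2 + (real n powr (-x))\<^sup>2"
      using sum_squares_bound[of "cmod (b n)" "real n powr (-x)"] by simp
    moreover have "(real n powr (-x))\<^sup>2 = real n powr (-(2 * x))"
      by (simp add: power2_eq_square powr_add[symmetric])
    moreover have "0 \<le> cmod (b n) * real n powr (-x)" by simp
    ultimately show "norm (cmod (b n) * real n powr (-x)) \<le> (cmod (b n))\<^sup>2 + real n powr (-(2 * x))"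
      unfolding real_norm_def by linarith
  qed
  have summ_c: "summable (\<lambda>n. c n * real n powr (-x))" if "x \<ge> \<tau>" for x
    using that by (intro V(1)) (auto simp: \<tau>_def)
  have "d N = 0"
  proof (rule dirichlet_coeffs_eq_0)
    \<comment> \<open>\<open>b 0 = 0\<close> is part of \<open>H2\<close>, and
      \<open>c 0 = 0\<close> because ln 0 = 0 makes it a division by zero.\<close>
    show "d 0 = 0" using b by (simp add: d_def H2_def c_def)
    show "summable (\<lambda>n. cmod (d n) * real n powr (-\<tau>))"
    proof (rule summable_comparison_test')
      show "summable (\<lambda>n. cmod (b n) * real n powr (-\<tau>) + c n * real n powr (-\<tau>))"
        by (intro summable_add summ_b summ_c) auto
      fix n
      have "cmod (d n) \<le> cmod (b n) + c n"
        using norm_triangle_ineq[of "b n" "of_real (c n)"] c_nonneg[of n] by (simp add: d_def)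
      then show "norm (cmod (d n) * real n powr (-\<tau>)) \<le>
          cmod (b n) * real n powr (-\<tau>) + c n * real n powr (-\<tau>)"
        by (simp add: distrib_right[symmetric] mult_right_mono)
    qed
    fix x :: real assume x: "x > \<tau>"
    have powr: "(of_nat n :: complex) powr (- of_real x) = of_real (real n powr (-x))" for n
      using of_nat_powr_of_real[of n "-x"] by simp
    have "summable (\<lambda>n. b n * of_nat n powr (- of_real x))"
    proof (rule summable_norm_cancel)
      show "summable (\<lambda>n. norm (b n * of_nat n powr (- of_real x)))"
        unfolding norm_mult powr using summ_b[of x] x by simp
    qed
    moreover have "summable (\<lambda>n. complex_of_real (c n * real n powr (-x)))"
      using summ_c[of x] x by (simp only: summable_of_real)
    ultimately have "dirichlet_series b (of_real x) + (\<Sum>n. complex_of_real (c n * real n powr (-x))) =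
        (\<Sum>n. b n * of_nat n powr (- of_real x) + of_real (c n * real n powr (-x)))"
      unfolding dirichlet_series_def by (rule suminf_add)
    also have "\<dots> = dirichlet_series d (of_real x)"
      unfolding dirichlet_series_def powr by (simp add: d_def distrib_right)
    finally have "dirichlet_series d (of_real x) =
      dirichlet_series b (of_real x) + of_real (\<Sum>n. c n * real n powr (-x))"
      using summ_c[of x] x by (simp only: suminf_of_real less_imp_le)
    also have "dirichlet_series b (of_real x) = - of_real (\<Sum>n. c n * real n powr (-x))"
      using eq[of "of_real x"] V(2)[of x] x by (simp add: \<tau>_def)
    finally show "dirichlet_series d (of_real x) = 0" by simp
  qed
  then show ?thesis by (simp add: d_def c_def add_eq_0_iff)
qed

section \<open>Boundedness as an inequality between finite sums\<close>

text \<open>The test function with coefficients 1 on \<open>D\<close> has squared norm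
  \<open>card D\<close>, while any finite part of the squared coefficients of its image is at most
  the squared norm of the image.\<close>

lemma volterra_bounded_imp_sum_le:
  assumes "volterra_bounded_on_H2 (zeta_primitive \<alpha>)"
  obtains C where "\<And>D T. finite D \<Longrightarrow> 0 \<notin> D \<Longrightarrow> finite T \<Longrightarrow>
    (\<Sum>N\<in>T. (proper_divisor_sum \<alpha> D N / ln (real N))\<^sup>2) \<le> C\<^sup>2 * real (card D)"
proof -
  obtain C where C: "\<forall>a\<in>H2. \<exists>b\<in>H2. (\<exists>\<sigma>. \<forall>s. Re s > \<sigma> \<longrightarrow>
           volterra (zeta_primitive \<alpha>) (dirichlet_series a) s = dirichlet_series b s) \<and>
        H2_norm b \<le> C * H2_norm a"
    using assms unfolding volterra_bounded_on_H2_def by blast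
  have "(\<Sum>N\<in>T. (proper_divisor_sum \<alpha> D N / ln (real N))\<^sup>2) \<le> C\<^sup>2 * real (card D)"
    if D: "finite D" "0 \<notin> D" and T: "finite T" for D T
  proof -
    let ?a = "indicator_coeffs D"
    have a_sums: "(\<lambda>n. (cmod (?a n))\<^sup>2) sums real (card D)"
    proof -
      have "(\<lambda>n. (cmod (?a n))\<^sup>2) sums (\<Sum>n\<in>D. (cmod (?a n))\<^sup>2)"
        by (rule sums_finite[OF D(1)]) (simp add: indicator_coeffs_def)
      then show ?thesis by (simp add: indicator_coeffs_def)
    qed
    then have "?a \<in> H2" using D by (auto simp: H2_def sums_iff indicator_coeffs_def)
    with C obtain b \<sigma> where b: "b \<in> H2" "H2_norm b \<le> C * H2_norm ?a"
      and eq: "\<And>s. Re s > \<sigma> \<Longrightarrow>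
        volterra (zeta_primitive \<alpha>) (dirichlet_series ?a) s = dirichlet_series b s"
      by blast
    have summ: "summable (\<lambda>n. (cmod (b n))\<^sup>2)" using b by (simp add: H2_def)
    have "(\<Sum>N\<in>T. (proper_divisor_sum \<alpha> D N / ln (real N))\<^sup>2) = (\<Sum>N\<in>T. (cmod (b N))\<^sup>2)"
      using volterra_indicator_coeffs_unique[OF D b(1) eq]
      by (intro sum.cong) (simp_all add: norm_divide power_divide del: of_real_divide)
    also have "\<dots> \<le> (\<Sum>n. (cmod (b n))\<^sup>2)" by (intro sum_le_suminf summ T) auto
    also have "\<dots> = (H2_norm b)\<^sup>2"
      unfolding H2_norm_def by (intro real_sqrt_pow2[symmetric] suminf_nonneg summ) auto
    \<comment> \<open>The sign of \<open>C\<close> is unknown; squaring is sound because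
      \<open>H2_norm b\<close> is nonnegative.\<close>
    also have "\<dots> \<le> (C * H2_norm ?a)\<^sup>2"
      by (intro power_mono b(2)) (simp add: H2_norm_def suminf_nonneg[OF summ])
    also have "\<dots> = C\<^sup>2 * real (card D)"
      using a_sums by (simp add: H2_norm_def power_mult_distrib sums_iff)
    finally show ?thesis .
  qed
  then show ?thesis using that by blast
qed

section \<open>Test functions supported on squarefree products of primes\<close>

text \<open>A set of primes is recovered from its product as the set of prime divisors.\<close>

lemma inj_on_prod_primes:
  fixes P :: "nat set"
  assumes "finite P" "\<And>p. p \<in> P \<Longrightarrow> prime p"
  shows "inj_on (\<lambda>A. \<Prod>A) (Pow P)"
proof (rule inj_on_inverseI)
  fix A assume "A \<in> Pow P"
  then have A: "finite A" "A \<subseteq> P" using assms finite_subset by auto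
  show "{p. prime p \<and> p dvd \<Prod>A} = A"
    using A assms by (auto simp: prime_dvd_prod_iff) (metis primes_dvd_imp_eq subsetD)
qed

text \<open>Expand the product of 1 + p^-\<alpha> over A: a subset B, where the summand 1 is chosen,
  contributes the cofactor of the divisor \<open>\<Prod>B\<close> to the power -\<alpha>. The choice
  B = A contributes the 1 that is subtracted, as \<open>\<Prod>A\<close> is not a proper divisor of
  itself. Each factor is bounded below by p^-\<alpha> \<ge> p^-\<beta> \<ge> x^-\<beta>.\<close>

lemma proper_divisor_sum_prod_primes_ge:
  assumes P: "finite P" "\<And>p. p \<in> P \<Longrightarrow> prime p" "\<And>p. p \<in> P \<Longrightarrow> real p \<le> x"
    and \<beta>: "\<alpha> \<le> \<beta>" "0 \<le> \<beta>" and A: "A \<subseteq> P"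
  shows "(1 + x powr (-\<beta>)) ^ card A - 1 \<le> proper_divisor_sum \<alpha> ((\<lambda>A. \<Prod>A) ` Pow P) (\<Prod>A)"
proof -
  have fA: "finite A" using A P finite_subset by blast
  have pos: "p > 0" if "p \<in> P" for p using P(2)[OF that] prime_gt_0_nat by blast
  have inj: "inj_on (\<lambda>A. \<Prod>A) (Pow P)" using P(1,2) by (rule inj_on_prod_primes)
  have split: "\<Prod>A = \<Prod>(A - B) * \<Prod>B" if "B \<subseteq> A" for B
    using prod.subset_diff[OF that fA] by simp
  have Bpos: "\<Prod>B > 0" if "B \<subseteq> P" for B using that pos by (intro prod_pos) auto
  have "(1 + x powr (-\<beta>)) ^ card A = (\<Prod>p\<in>A. 1 + x powr (-\<beta>))" by simp
  also have "\<dots> \<le> (\<Prod>p\<in>A. 1 + real p powr (-\<alpha>))"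
  proof (intro prod_mono conjI add_left_mono)
    fix p assume "p \<in> A"
    then have p: "real p \<ge> 1" "real p \<le> x" using A P(3) pos[of p] by force+
    have "x powr (-\<beta>) \<le> real p powr (-\<beta>)" using p \<beta> by (intro powr_mono2') auto
    also have "\<dots> \<le> real p powr (-\<alpha>)" using p \<beta> by (intro powr_mono) auto
    finally show "x powr (-\<beta>) \<le> real p powr (-\<alpha>)" .
  qed (auto intro: add_nonneg_nonneg)
  also have "\<dots> = (\<Sum>B\<in>Pow A. real (\<Prod>(A - B)) powr (-\<alpha>))"
    unfolding prod_add[OF fA] by (simp add: prod_powr_distrib)
  also have "\<dots> = real (\<Prod>(A - A)) powr (-\<alpha>) + (\<Sum>B\<in>Pow A - {A}. real (\<Prod>(A - B)) powr (-\<alpha>))"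
    using fA by (intro sum.remove) auto
  also have "(\<Sum>B\<in>Pow A - {A}. real (\<Prod>(A - B)) powr (-\<alpha>)) =
      (\<Sum>B\<in>Pow A - {A}. real (\<Prod>A div \<Prod>B) powr (-\<alpha>))"
  proof (intro sum.cong refl)
    fix B assume "B \<in> Pow A - {A}"
    then have "B \<subseteq> A" by auto
    then show "real (\<Prod>(A - B)) powr (-\<alpha>) = real (\<Prod>A div \<Prod>B) powr (-\<alpha>)"
      using Bpos[of B] A split[of B] by simp
  qed
  also have "\<dots> = (\<Sum>m\<in>(\<lambda>A. \<Prod>A) ` (Pow A - {A}). real (\<Prod>A div m) powr (-\<alpha>))"
    using inj A by (subst sum.reindex) (auto intro: inj_on_subset simp: o_def)
  also have "\<dots> \<le> proper_divisor_sum \<alpha> ((\<lambda>A. \<Prod>A) ` Pow P) (\<Prod>A)"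
    unfolding proper_divisor_sum_def
  proof (rule sum_mono2)
    show "(\<lambda>A. \<Prod>A) ` (Pow A - {A}) \<subseteq> {m \<in> (\<lambda>A. \<Prod>A) ` Pow P. m dvd \<Prod>A \<and> m < \<Prod>A}"
    proof
      fix m assume "m \<in> (\<lambda>A. \<Prod>A) ` (Pow A - {A})"
      then obtain B where B: "B \<subseteq> A" "B \<noteq> A" "m = \<Prod>B" by auto
      have dvd: "m dvd \<Prod>A" using split[OF B(1)] B(3) by simp
      have "m \<noteq> \<Prod>A" using inj_onD[OF inj, of B A] B A by auto
      moreover have "m \<le> \<Prod>A" using dvd Bpos[OF A] by (intro dvd_imp_le)
      ultimately show "m \<in> {m \<in> (\<lambda>A. \<Prod>A) ` Pow P. m dvd \<Prod>A \<and> m < \<Prod>A}"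
        using dvd B A by auto
    qed
  qed (use P(1) in auto)
  finally show ?thesis by simp
qed

text \<open>The sum of q^(2|A|) over A \<subseteq> P is (1 + q^2)^K \<ge> 2^K q^K. The factor 2^K
  cancels against the number of divisors, and q^K survives.\<close>

lemma prime_products_lower_bound:
  assumes P: "finite P" "\<And>p. p \<in> P \<Longrightarrow> prime p" "\<And>p. p \<in> P \<Longrightarrow> real p \<le> x"
    and \<beta>: "\<alpha> \<le> \<beta>" "0 \<le> \<beta>" and x: "x > 1" and C: "\<And>T. finite T \<Longrightarrow>
      (\<Sum>N\<in>T. (proper_divisor_sum \<alpha> ((\<lambda>A. \<Prod>A) ` Pow P) N / ln (real N))\<^sup>2) \<le>
      C\<^sup>2 * real (card ((\<lambda>A. \<Prod>A) ` Pow P))"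
    and nonempty: "P \<noteq> {}"
  shows "(1 + x powr (-\<beta>)) ^ card P / 2 - 1 \<le> C\<^sup>2 * (real (card P) * ln x)\<^sup>2"
proof -
  define D where "D = (\<lambda>A. \<Prod>A) ` Pow P"
  define q where "q = 1 + x powr (-\<beta>)"
  define L where "L = real (card P) * ln x"
  define K where "K = card P"
  have q: "q \<ge> 1" by (simp add: q_def)
  have Lpos: "L > 0" using nonempty P(1) x by (simp add: L_def card_gt_0_iff)
  have inj: "inj_on (\<lambda>A. \<Prod>A) (Pow P)" using P(1,2) by (rule inj_on_prod_primes)
  have card_D: "card D = 2 ^ K" unfolding D_def K_def using card_image[OF inj] P(1) by (simp add: card_Pow)
  have lower: "((q\<^sup>2) ^ card A / 2 - 1) / L\<^sup>2 \<le> (proper_divisor_sum \<alpha> D (\<Prod>A) / ln (real (\<Prod>A)))\<^sup>2"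
    if A: "A \<subseteq> P" for A
  proof -
    define u where "u = q ^ card A"
    have u: "u \<ge> 1" unfolding u_def using q by (rule one_le_power)
    have fA: "finite A" using A P(1) finite_subset by blast
    have e: "u - 1 \<le> proper_divisor_sum \<alpha> D (\<Prod>A)"
      unfolding u_def q_def D_def using P \<beta> A by (rule proper_divisor_sum_prod_primes_ge)
    have p: "real p \<ge> 2" "real p \<le> x" if "p \<in> A" for p
      using that A P(2,3)[of p] prime_ge_2_nat[of p] by auto
    have "(u - 1) / L \<le> proper_divisor_sum \<alpha> D (\<Prod>A) / ln (real (\<Prod>A))"
    \<comment> \<open>For A = {} both sides are 0: u = 1 on the left, division by ln 1 = 0 on the
      right. Otherwise the denominator lies between 0 and L, since each of the at most K primes
      contributes at most ln x.\<close>
    proof (cases "A = {}")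
      case False
      have "real (\<Prod>A) > 1"
      proof -
        obtain p where "p \<in> A" using False by blast
        have "1 < real p" "0 \<notin> A" using p[OF \<open>p \<in> A\<close>] p[of 0] by auto
        note this(1)
        also have "p dvd \<Prod>A" using fA \<open>p \<in> A\<close> by (intro dvd_prod_eqI) auto
        then have "p \<le> \<Prod>A"
          using \<open>0 \<notin> A\<close> by (intro dvd_imp_le prod_pos) (auto intro!: Nat.gr0I)
        then have "real p \<le> real (\<Prod>A)" by (simp only: of_nat_le_iff)
        finally show ?thesis .
      qed
      moreover have "ln (real (\<Prod>A)) \<le> L"
      proof -
        have "ln (real (\<Prod>A)) = (\<Sum>p\<in>A. ln (real p))"
          unfolding of_nat_prod using p fA by (subst ln_prod) force+
        also have "\<dots> \<le> (\<Sum>p\<in>A. ln x)" using p x by (intro sum_mono) force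
        also have "\<dots> \<le> L" unfolding L_def using card_mono[OF P(1) A] x by (simp add: mult_right_mono)
        finally show ?thesis .
      qed
      ultimately show ?thesis using u e by (intro frac_le) auto
    qed (use u_def in simp)
    then have sq: "((u - 1) / L)\<^sup>2 \<le> (proper_divisor_sum \<alpha> D (\<Prod>A) / ln (real (\<Prod>A)))\<^sup>2"
      using u Lpos by (intro power_mono) auto
    \<comment> \<open>The difference of the two sides is (u - 2)^2 / 2.\<close>
    have "u\<^sup>2 / 2 - 1 \<le> (u - 1)\<^sup>2"
      using zero_le_power2[of "u - 2"] by (simp add: power2_eq_square algebra_simps)
    then have "(u\<^sup>2 / 2 - 1) / L\<^sup>2 \<le> ((u - 1) / L)\<^sup>2"
      unfolding power_divide by (rule divide_right_mono) simp
    also note sq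
    also have "u\<^sup>2 = (q\<^sup>2) ^ card A" by (simp add: u_def power_mult[symmetric] mult.commute)
    finally show ?thesis .
  qed
  have "(\<Sum>A\<in>Pow P. (q\<^sup>2) ^ card A) = (q\<^sup>2 + 1) ^ K"
    using prod_add[OF P(1), of "\<lambda>_. q\<^sup>2" "\<lambda>_. 1"] by (simp add: K_def)
  moreover have "(2 * q) ^ K \<le> (q\<^sup>2 + 1) ^ K"
  proof (rule power_mono)
    show "2 * q \<le> q\<^sup>2 + 1" using zero_le_power2[of "q - 1"] by (simp add: power2_eq_square algebra_simps)
  qed (use q in simp)
  ultimately have "2 ^ K * q ^ K \<le> (\<Sum>A\<in>Pow P. (q\<^sup>2) ^ card A)" by (simp add: power_mult_distrib)
  then have "2 ^ K * (q ^ K / 2 - 1) \<le> (\<Sum>A\<in>Pow P. (q\<^sup>2) ^ card A / 2 - 1)"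
    using P(1) by (simp add: sum_subtractf sum_divide_distrib[symmetric] card_Pow K_def algebra_simps)
  then have "2 ^ K * (q ^ K / 2 - 1) / L\<^sup>2 \<le> (\<Sum>A\<in>Pow P. ((q\<^sup>2) ^ card A / 2 - 1) / L\<^sup>2)"
    unfolding sum_divide_distrib[symmetric] by (rule divide_right_mono) simp
  also have "\<dots> \<le> (\<Sum>A\<in>Pow P. (proper_divisor_sum \<alpha> D (\<Prod>A) / ln (real (\<Prod>A)))\<^sup>2)"
    by (intro sum_mono lower) auto
  also have "\<dots> = (\<Sum>N\<in>D. (proper_divisor_sum \<alpha> D N / ln (real N))\<^sup>2)"
    unfolding D_def using inj by (subst sum.reindex) (auto simp: o_def)
  also have "\<dots> \<le> C\<^sup>2 * 2 ^ K"
    using C[of D] P(1) card_D by (simp add: D_def)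
  finally have "2 ^ K * ((q ^ K / 2 - 1) / L\<^sup>2) \<le> 2 ^ K * C\<^sup>2" by (simp add: mult.commute)
  then have "(q ^ K / 2 - 1) / L\<^sup>2 \<le> C\<^sup>2" by (rule mult_left_le_imp_le) simp
  then have "q ^ K / 2 - 1 \<le> C\<^sup>2 * L\<^sup>2"
    using pos_divide_le_eq[of "L\<^sup>2"] Lpos by simp
  then show ?thesis by (simp only: q_def K_def L_def)
qed

section \<open>The contradiction\<close>

theorem theorem3p1:
  fixes \<alpha> :: real
  assumes "\<alpha> < 1"
  shows "\<not> volterra_bounded_on_H2 (zeta_primitive \<alpha>)"
proof
  assume "volterra_bounded_on_H2 (zeta_primitive \<alpha>)"
  then obtain C where C: "\<And>D T. finite D \<Longrightarrow> 0 \<notin> D \<Longrightarrow> finite T \<Longrightarrow>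
    (\<Sum>N\<in>T. (proper_divisor_sum \<alpha> D N / ln (real N))\<^sup>2) \<le> C\<^sup>2 * real (card D)"
    using volterra_bounded_imp_sum_le by blast
  \<comment> \<open>The value 1/2 keeps \<open>\<beta>\<close> positive when \<alpha> \<le> 0; any
    number strictly between 0 and 1 would serve.\<close>
  define \<beta> where "\<beta> = max \<alpha> (1 / 2)"
  have \<beta>: "\<alpha> \<le> \<beta>" "0 < \<beta>" "\<beta> < 1" using assms by (auto simp: \<beta>_def)
  \<comment> \<open>The prime count is bounded at even integers, so the real asymptotics are sampled
    along x = 2k.\<close>
  have lim: "filterlim (\<lambda>k::nat. 2 * real k) at_top sequentially" by real_asymp
  have "eventually (\<lambda>k::nat. C\<^sup>2 * (2 * real k * ln (2 * real k))\<^sup>2 <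
      exp (ln 2 * (2 * real k) / (2 * ln (2 * real k)) * ln (1 + (2 * real k) powr -\<beta>)) / 2 - 1) sequentially"
    using eventually_compose_filterlim[OF prime_growth_dominates[OF \<beta>(2,3), of "C\<^sup>2"] lim] .
  from eventually_happens[OF eventually_conj[OF this eventually_ge_at_top[of 1]]]
  obtain k :: nat where k: "k \<ge> 1" and less: "C\<^sup>2 * (2 * real k * ln (2 * real k))\<^sup>2 <
      exp (ln 2 * (2 * real k) / (2 * ln (2 * real k)) * ln (1 + (2 * real k) powr -\<beta>)) / 2 - 1"
    by auto
  define x where "x = 2 * real k"
  define P where "P = {p. prime p \<and> p \<le> 2 * k}"
  define K where "K = card P"
  have x: "x > 1" using k by (simp add: x_def)
  have P: "finite P" "\<And>p. p \<in> P \<Longrightarrow> prime p" "\<And>p. p \<in> P \<Longrightarrow> real p \<le> x"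
    unfolding P_def x_def by auto
  have "2 \<in> P" using k by (simp add: P_def)
  have no0: "0 \<notin> (\<lambda>A. \<Prod>A) ` Pow P"
  proof
    assume "0 \<in> (\<lambda>A. \<Prod>A) ` Pow P"
    then obtain A where "A \<subseteq> P" "\<Prod>A = 0" by auto
    then have "0 \<in> P" using finite_subset[OF _ P(1)] by (auto simp: prod_zero_iff)
    then show False using P(2)[of 0] by simp
  qed
  \<comment> \<open>The trivial bound K \<le> x is enough for the polynomial side, which the
    exponential outgrows anyway.\<close>
  have "K \<le> card {1..2 * k}"
    unfolding K_def by (rule card_mono) (auto simp: P_def prime_ge_Suc_0_nat)
  then have Kx: "real K \<le> x" unfolding x_def by simp
  have "2 ^ k \<le> (2 * k) ^ K" unfolding K_def P_def by (rule two_power_le_prime_count[OF k])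
  then have "real (2 ^ k) \<le> real ((2 * k) ^ K)" by (simp only: of_nat_le_iff)
  \<comment> \<open>This reads k ln 2 \<le> K ln x; substituting k = x / 2 gives the lower bound on
    K.\<close>
  then have "ln (2 ^ k) \<le> ln (x ^ K)" using x by (subst ln_le_cancel_iff) (auto simp: x_def)
  then have K_ge: "ln 2 * x / (2 * ln x) \<le> real K"
    using x by (subst (asm) (1 2) ln_realpow) (auto simp: pos_divide_le_eq x_def algebra_simps)
  have "exp (ln 2 * x / (2 * ln x) * ln (1 + x powr -\<beta>)) \<le> exp (real K * ln (1 + x powr -\<beta>))"
    using K_ge by (intro exp_le_cancel_iff[THEN iffD2] mult_right_mono) auto
  also have "\<dots> = (1 + x powr -\<beta>) ^ K"
    by (simp add: exp_of_nat_mult add_pos_nonneg)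
  finally have "C\<^sup>2 * (x * ln x)\<^sup>2 < (1 + x powr -\<beta>) ^ K / 2 - 1"
    using less unfolding x_def by linarith
  also have "\<dots> \<le> C\<^sup>2 * (real K * ln x)\<^sup>2"
    unfolding K_def using P \<beta> x C[OF _ no0] \<open>2 \<in> P\<close>
    by (intro prime_products_lower_bound) auto
  also have "\<dots> \<le> C\<^sup>2 * (x * ln x)\<^sup>2"
    using Kx x by (intro mult_left_mono power_mono mult_right_mono) auto
  finally show False by simp
qed

end
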